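(* Let $\theta,\theta'\in\mathbb{R}$ and let $$|\mathrm{Mmee}\rangle_{AB}=\frac{1}{\sqrt{2}}\left(|00\rangle_{AB}+|11\rangle_{AB}\right),\qquad |\mathrm{mMee}\rangle_{AB}=\frac{1}{\sqrt{2}}\left(e^{i\theta}|01\rangle_{AB}+e^{i\theta'}|10\rangle_{AB}\right).$$ The pairs of entangled non-diagonal states completing these two states to an orthonormal basis of $\mathbb{C}^2\otimes\mathbb{C}^2$ are, up to global phases, exactly the pairs characterized by two complex numbers $a,b$ satisfying $$|a|^2+|b|^2=\frac12,\qquad e^{i(\theta'-\theta)}b^2\neq a^2,\qquad D:=e^{i\frac{\theta'-\theta}{2}}a^*b+e^{-i\frac{\theta'-\theta}{2}}ab^*\neq0,$$ through the Schmidt decompositions $$|\mathrm{mmEe}\rangle_{AB}=\sum_{j=0}^1\tau_j|\alpha_j\rangle_A\otimes|\beta_j\rangle_B,\qquad |\mathrm{mmeE}\rangle_{AB}=\sum_{j=0}^1\tau_j(-1)^j|\beta_j^*\rangle_A\otimes|\alpha_j^*\rangle_B,$$ where $$\tau_j=\left(\frac{1+(-1)^j\sqrt{1-4\left|a^2-e^{i(\theta'-\theta)}b^2\right|^2}}{2}\right)^{1/2},\qquad C_j=e^{-i\frac{\theta'-\theta}{2}}\frac{D}{|D|}a+(-1)^jb,$$ $$|\alpha_j\rangle_A=\frac{1}{\sqrt2}\frac{C_j}{|C_j|}\begin{bmatrix}-e^{-i\frac{\theta'-\theta}{2}}\frac{D}{|D|}\\(-1)^j\end{bmatrix},\qquad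 |\beta_j\rangle_B=\frac{1}{\sqrt2}\begin{bmatrix}e^{i\frac{\theta'-\theta}{2}}\frac{D}{|D|}\\(-1)^j\end{bmatrix}.$$
   Context: $|0\rangle,|1\rangle$ is the standard basis of $\mathbb{C}^2$, $|jk\rangle_{AB}=|j\rangle_A\otimes|k\rangle_B$, column vectors are with respect to the standard basis, $^*$ on scalars is complex conjugation, and $|\alpha^*\rangle$ is the entrywise complex conjugate of $|\alpha\rangle$. A state is a unit vector; a state in $\mathbb{C}^2\otimes\mathbb{C}^2$ is a product state if it equals $|u\rangle\otimes|v\rangle$, and entangled otherwise. A state $\sum_{j,k}c_{jk}|jk\rangle_{AB}$ is called diagonal if $c_{00}^*c_{01}+c_{10}^*c_{11}=0$, and non-diagonal otherwise. A Schmidt decomposition of a state is an expression $\sum_j\lambda_j|u_j\rangle\otimes|v_j\rangle$ with $\lambda_j\ge 0$ (the Schmidt coefficients) and $\{|u_j\rangle\}$, $\{|v_j\rangle\}$ orthonormal families in $\mathbb{C}^2$ (signs may be absorbed into either tensor factor). "Up to global phases" means each state may be multiplied by a complex number of modulus one. *)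

theory Defs
  imports "HOL-Analysis.Analysis"
begin

text \<open>The index type \<open>2\<close> has exactly the elements \<open>0\<close> and \<open>1\<close>; its numeral \<open>2\<close> equals \<open>0\<close>.
  The components of a qubit vector \<open>u\<close> are written \<open>u $ 0\<close> and \<open>u $ 1\<close>, in this order;
  note that the library's \<open>vector [x, y]\<close> would put \<open>x\<close> at \<open>1\<close> and \<open>y\<close> at \<open>2 = 0\<close>.
  The space $\mathbb{C}^2\otimes\mathbb{C}^2$ is \<open>complex ^ (2 \<times> 2)\<close>, where the component at
  \<open>(j, k)\<close> is the coefficient of the basis vector $|jk\rangle$.\<close>

type_synonym qubit = "complex ^ 2"
type_synonym two_qubit = "complex ^ (2 \<times> 2)"

definition col2 :: "complex \<Rightarrow> complex \<Rightarrow> qubit" where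
  "col2 x y = (\<chi> i. if i = 0 then x else y)"

definition ket :: "2 \<Rightarrow> qubit" where
  "ket j = axis j 1"

definition tensor :: "qubit \<Rightarrow> qubit \<Rightarrow> two_qubit"  (infixr "\<otimes>" 75) where
  "u \<otimes> v = (\<chi> p. u $ fst p * v $ snd p)"

definition cnj_vec :: "complex ^ 'n \<Rightarrow> complex ^ 'n" where
  "cnj_vec u = (\<chi> i. cnj (u $ i))"

text \<open>The library's inner product on \<open>complex ^ 'n\<close> is the real one; this is the Hermitian one.
  Both induce the library's \<open>norm\<close>.\<close>

definition hinner :: "complex ^ 'n \<Rightarrow> complex ^ 'n \<Rightarrow> complex" where
  "hinner u v = (\<Sum>i\<in>UNIV. cnj (u $ i) * v $ i)"

definition orthonormal_family :: "'j set \<Rightarrow> ('j \<Rightarrow> complex ^ 'n) \<Rightarrow> bool" where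
  "orthonormal_family J u \<longleftrightarrow> (\<forall>i\<in>J. \<forall>j\<in>J. hinner (u i) (u j) = (if i = j then 1 else 0))"

text \<open>Here \<open>vec.span\<close> is the span over the complex numbers.\<close>

definition orthonormal_basis :: "(complex ^ 'n) list \<Rightarrow> bool" where
  "orthonormal_basis us \<longleftrightarrow>
     orthonormal_family {..<length us} (\<lambda>i. us ! i) \<and> vec.span (set us) = UNIV"

definition is_state :: "complex ^ 'n \<Rightarrow> bool" where
  "is_state \<psi> \<longleftrightarrow> norm \<psi> = 1"

definition product_state :: "two_qubit \<Rightarrow> bool" where
  "product_state \<psi> \<longleftrightarrow> is_state \<psi> \<and> (\<exists>u v. \<psi> = u \<otimes> v)"

definition entangled :: "two_qubit \<Rightarrow> bool" where
  "entangled \<psi> \<longleftrightarrow> is_state \<psi> \<and> \<not> product_state \<psi>"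

definition diagonal :: "two_qubit \<Rightarrow> bool" where
  "diagonal \<psi> \<longleftrightarrow> is_state \<psi> \<and>
     cnj (\<psi> $ (0, 0)) * \<psi> $ (0, 1) + cnj (\<psi> $ (1, 0)) * \<psi> $ (1, 1) = 0"

definition non_diagonal :: "two_qubit \<Rightarrow> bool" where
  "non_diagonal \<psi> \<longleftrightarrow> is_state \<psi> \<and> \<not> diagonal \<psi>"

definition schmidt_decomposition ::
    "nat \<Rightarrow> (nat \<Rightarrow> real) \<Rightarrow> (nat \<Rightarrow> qubit) \<Rightarrow> (nat \<Rightarrow> qubit) \<Rightarrow> two_qubit \<Rightarrow> bool" where
  "schmidt_decomposition n l u v \<psi> \<longleftrightarrow>
     is_state \<psi> \<and> (\<forall>j<n. 0 \<le> l j) \<and>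
     orthonormal_family {..<n} u \<and> orthonormal_family {..<n} v \<and>
     \<psi> = (\<Sum>j<n. complex_of_real (l j) *s (u j \<otimes> v j))"

definition Mmee :: two_qubit where
  "Mmee = complex_of_real (1 / sqrt 2) *s (ket 0 \<otimes> ket 0 + ket 1 \<otimes> ket 1)"

definition mMee :: "real \<Rightarrow> real \<Rightarrow> two_qubit" where
  "mMee \<theta> \<theta>' = complex_of_real (1 / sqrt 2) *s
     (exp (\<i> * \<theta>) *s (ket 0 \<otimes> ket 1) + exp (\<i> * \<theta>') *s (ket 1 \<otimes> ket 0))"

definition Dval :: "real \<Rightarrow> real \<Rightarrow> complex \<Rightarrow> complex \<Rightarrow> complex" where
  "Dval \<theta> \<theta>' a b =
     exp (\<i> * ((\<theta>' - \<theta>) / 2)) * cnj a * b + exp (- \<i> * ((\<theta>' - \<theta>) / 2)) * a * cnj b"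

text \<open>\<open>Dval\<close> is real (it is a sum of two complex conjugates), so $D/|D| = \pm 1$ where it is nonzero.
  With $|a|^2+|b|^2 = 1/2$ both radicands in \<open>tau\<close> below are nonnegative, so the library's
  convention for square roots of negative reals plays no role.\<close>

definition admissible :: "real \<Rightarrow> real \<Rightarrow> complex \<Rightarrow> complex \<Rightarrow> bool" where
  "admissible \<theta> \<theta>' a b \<longleftrightarrow>
     (cmod a)\<^sup>2 + (cmod b)\<^sup>2 = 1 / 2 \<and>
     exp (\<i> * (\<theta>' - \<theta>)) * b\<^sup>2 \<noteq> a\<^sup>2 \<and>
     Dval \<theta> \<theta>' a b \<noteq> 0"

definition tau :: "real \<Rightarrow> real \<Rightarrow> complex \<Rightarrow> complex \<Rightarrow> nat \<Rightarrow> real" where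
  "tau \<theta> \<theta>' a b j =
     sqrt ((1 + (-1) ^ j * sqrt (1 - 4 * (cmod (a\<^sup>2 - exp (\<i> * (\<theta>' - \<theta>)) * b\<^sup>2))\<^sup>2)) / 2)"

definition Cval :: "real \<Rightarrow> real \<Rightarrow> complex \<Rightarrow> complex \<Rightarrow> nat \<Rightarrow> complex" where
  "Cval \<theta> \<theta>' a b j =
     exp (- \<i> * ((\<theta>' - \<theta>) / 2)) * (Dval \<theta> \<theta>' a b / cmod (Dval \<theta> \<theta>' a b)) * a + (-1) ^ j * b"

definition alpha :: "real \<Rightarrow> real \<Rightarrow> complex \<Rightarrow> complex \<Rightarrow> nat \<Rightarrow> qubit" where
  "alpha \<theta> \<theta>' a b j =
     (complex_of_real (1 / sqrt 2) * (Cval \<theta> \<theta>' a b j / cmod (Cval \<theta> \<theta>' a b j))) *s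
     col2 (- exp (- \<i> * ((\<theta>' - \<theta>) / 2)) * (Dval \<theta> \<theta>' a b / cmod (Dval \<theta> \<theta>' a b)))
          ((-1) ^ j)"

definition beta :: "real \<Rightarrow> real \<Rightarrow> complex \<Rightarrow> complex \<Rightarrow> nat \<Rightarrow> qubit" where
  "beta \<theta> \<theta>' a b j =
     complex_of_real (1 / sqrt 2) *s
     col2 (exp (\<i> * ((\<theta>' - \<theta>) / 2)) * (Dval \<theta> \<theta>' a b / cmod (Dval \<theta> \<theta>' a b)))
          ((-1) ^ j)"

definition mmEe :: "real \<Rightarrow> real \<Rightarrow> complex \<Rightarrow> complex \<Rightarrow> two_qubit" where
  "mmEe \<theta> \<theta>' a b =
     (\<Sum>j = 0..1. complex_of_real (tau \<theta> \<theta>' a b j) *s (alpha \<theta> \<theta>' a b j \<otimes> beta \<theta> \<theta>' a b j))"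

definition mmeE :: "real \<Rightarrow> real \<Rightarrow> complex \<Rightarrow> complex \<Rightarrow> two_qubit" where
  "mmeE \<theta> \<theta>' a b =
     (\<Sum>j = 0..1. (complex_of_real (tau \<theta> \<theta>' a b j) * (-1) ^ j) *s
        (cnj_vec (beta \<theta> \<theta>' a b j) \<otimes> cnj_vec (alpha \<theta> \<theta>' a b j)))"

end

theory Submission
  imports Defs
begin

text \<open>With $e = e^{i(\theta'-\theta)/2}$, the vectors orthogonal to the two given states are
  $(a, b, -e^2 b, -a)$, and the unit vector of this kind orthogonal to that one is, up to a phase,
  obtained by replacing $(a, b)$ with $(-b^*, a^*)$. The three conditions on $a, b$ say that the
  vector has norm one, nonzero determinant (entangled) and is non-diagonal, and they are invariant
  under the replacement. The Schmidt form comes from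
  $|a^2 - e^2 b^2|^2 + D^2 = (|a|^2 + |b|^2)^2$, which gives $\tau_j = |C_j|$: the moduli then
  cancel and the two Schmidt sums have the coordinates above, up to the phase $-e^* D/|D|$ in the
  first one.\<close>

section \<open>Coordinates of one- and two-qubit vectors\<close>

lemma UNIV_2': "(UNIV :: 2 set) = {0, 1}"
proof -
  have "(2 :: 2) = 0" by simp
  then show ?thesis using UNIV_2 by auto
qed

lemma UNIV_2_times_2: "(UNIV :: (2 \<times> 2) set) = {(0, 0), (0, 1), (1, 0), (1, 1)}"
  unfolding UNIV_Times_UNIV[symmetric] UNIV_2' by auto

lemma two_qubit_eq_iff:
  "\<psi> = \<phi> \<longleftrightarrow> \<psi> $ (0, 0) = \<phi> $ (0, 0) \<and> \<psi> $ (0, 1) = \<phi> $ (0, 1) \<and>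
    \<psi> $ (1, 0) = \<phi> $ (1, 0) \<and> \<psi> $ (1, 1) = \<phi> $ (1, 1)" for \<psi> \<phi> :: two_qubit
proof -
  have "\<psi> = \<phi> \<longleftrightarrow> (\<forall>p\<in>UNIV. \<psi> $ p = \<phi> $ p)" by (simp add: vec_eq_iff)
  then show ?thesis unfolding UNIV_2_times_2 by simp
qed

lemma hinner_qubit: "hinner u v = cnj (u $ 0) * v $ 0 + cnj (u $ 1) * v $ 1" for u v :: qubit
  by (simp add: hinner_def UNIV_2')

lemma hinner_two_qubit:
  "hinner \<psi> \<phi> = cnj (\<psi> $ (0, 0)) * \<phi> $ (0, 0) + cnj (\<psi> $ (0, 1)) * \<phi> $ (0, 1) +
    cnj (\<psi> $ (1, 0)) * \<phi> $ (1, 0) + cnj (\<psi> $ (1, 1)) * \<phi> $ (1, 1)" for \<psi> \<phi> :: two_qubit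
  by (simp add: hinner_def UNIV_2_times_2)

lemma tensor_nth [simp]: "(u \<otimes> v) $ (j, k) = u $ j * v $ k"
  by (simp add: tensor_def)

lemma col2_nth [simp]: "col2 x y $ 0 = x" "col2 x y $ 1 = y"
  by (simp_all add: col2_def)

lemma ket_nth [simp]: "ket j $ k = (if k = j then 1 else 0)"
  by (simp add: ket_def axis_def)

lemma cnj_vec_nth [simp]: "cnj_vec u $ j = cnj (u $ j)"
  by (simp add: cnj_vec_def)

section \<open>The Hermitian inner product and orthonormal bases\<close>

lemma cnj_hinner: "cnj (hinner u v) = hinner v u"
  by (simp add: hinner_def mult.commute)

lemma hinner_self: "hinner u u = complex_of_real ((norm u)\<^sup>2)"
  by (simp add: hinner_def norm_vec_def L2_set_def sum_nonneg complex_norm_square mult.commute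
      del: of_real_power)

lemma is_state_iff_hinner: "is_state u \<longleftrightarrow> hinner u u = 1"
  unfolding is_state_def hinner_self
  by (metis norm_ge_zero of_real_1 of_real_eq_iff power2_eq_1_iff power_one
      le_minus_one_simps(3))

lemma hinner_sum_right: "hinner u (\<Sum>i\<in>I. c i *s v i) = (\<Sum>i\<in>I. c i * hinner u (v i))"
  unfolding hinner_def
  by (simp add: sum_distrib_left sum_distrib_right mult_ac, rule sum.swap)

text \<open>Pairing a vanishing linear combination with a member of the family isolates that
  member's coefficient, so the family is independent; with as many members as the dimension, it
  spans.\<close>

lemma orthonormal_basis_iff:
  fixes us :: "(complex ^ 'n) list"
  assumes "length us = CARD('n)"
  shows "orthonormal_basis us \<longleftrightarrow> orthonormal_family {..<length us} (\<lambda>i. us ! i)"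
proof
  assume on: "orthonormal_family {..<length us} (\<lambda>i. us ! i)"
  \<comment> \<open>An entry repeated at two indices would have inner product both 0 and 1 with
    itself.\<close>
  have "distinct us"
    unfolding distinct_conv_nth
    using on by (metis lessThan_iff orthonormal_family_def zero_neq_one)
  then have inj: "inj_on ((!) us) {..<length us}" and card: "card (set us) = CARD('n)"
    using assms by (auto simp: inj_on_nth distinct_card)
  have img: "set us = (!) us ` {..<length us}"
    by (metis atLeast0LessThan list.set_map map_nth set_upt)
  have "vec.independent (set us)"
  proof (rule vec.independent_if_scalars_zero)
    fix f x assume 0: "(\<Sum>x\<in>set us. f x *s x) = 0" and "x \<in> set us"
    then obtain i where i: "i < length us" "x = us ! i" by (auto simp: in_set_conv_nth)
    have "0 = hinner x (\<Sum>x\<in>set us. f x *s x)" using 0 by (simp add: hinner_def)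
    also have "\<dots> = (\<Sum>j<length us. f (us ! j) * hinner x (us ! j))"
      unfolding hinner_sum_right img using inj by (simp add: sum.reindex)
    also have "\<dots> = (\<Sum>j<length us. if j = i then f x else 0)"
      using on i by (intro sum.cong) (auto simp: orthonormal_family_def)
    also have "\<dots> = f x" using i by simp
    finally show "f x = 0" by simp
  qed simp
  then have "UNIV \<subseteq> vec.span (set us)"
    using card by (intro vec.card_ge_dim_independent) (auto simp: vec_dim_card simp del: vec.dim_UNIV)
  then show "orthonormal_basis us" using on by (auto simp: orthonormal_basis_def)
qed (simp add: orthonormal_basis_def)

text \<open>Hermitian symmetry reduces the twelve off-diagonal conditions to six.\<close>

lemma orthonormal_family_4:
  "orthonormal_family {..<4} (\<lambda>i. [u, v, w, x] ! i) \<longleftrightarrow>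
    is_state u \<and> is_state v \<and> is_state w \<and> is_state x \<and>
    hinner u v = 0 \<and> hinner u w = 0 \<and> hinner u x = 0 \<and>
    hinner v w = 0 \<and> hinner v x = 0 \<and> hinner w x = 0"
proof -
  have "{..<4::nat} = {0, 1, 2, 3}" by auto
  moreover have "hinner p q = 0 \<longleftrightarrow> hinner q p = 0" for p q :: "complex ^ 'a"
    by (metis cnj_hinner complex_cnj_zero)
  ultimately show ?thesis
    by (auto simp: orthonormal_family_def is_state_iff_hinner)
qed

section \<open>Entanglement as a nonzero determinant\<close>

text \<open>The coefficients form a 2 by 2 matrix, and tensor products are the matrices of rank at
  most one. The factors are read off from a nonzero entry of the first row, or from the second row
  if the first one vanishes.\<close>

lemma product_iff_det:
  "(\<exists>u v. \<psi> = u \<otimes> v) \<longleftrightarrow> \<psi> $ (0, 0) * \<psi> $ (1, 1) = \<psi> $ (0, 1) * \<psi> $ (1, 0)"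
proof
  assume det: "\<psi> $ (0, 0) * \<psi> $ (1, 1) = \<psi> $ (0, 1) * \<psi> $ (1, 0)"
  consider "\<psi> $ (0, 0) \<noteq> 0" | "\<psi> $ (0, 0) = 0" "\<psi> $ (0, 1) \<noteq> 0" | "\<psi> $ (0, 0) = 0" "\<psi> $ (0, 1) = 0"
    by blast
  then show "\<exists>u v. \<psi> = u \<otimes> v"
  proof cases
    case 1
    then have "\<psi> = col2 1 (\<psi> $ (1, 0) / \<psi> $ (0, 0)) \<otimes> col2 (\<psi> $ (0, 0)) (\<psi> $ (0, 1))"
      using det by (simp add: two_qubit_eq_iff field_simps)
    then show ?thesis by blast
  next
    case 2
    then have "\<psi> = col2 1 (\<psi> $ (1, 1) / \<psi> $ (0, 1)) \<otimes> col2 0 (\<psi> $ (0, 1))"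
      using det by (simp add: two_qubit_eq_iff)
    then show ?thesis by blast
  next
    case 3
    then have "\<psi> = col2 0 1 \<otimes> col2 (\<psi> $ (1, 0)) (\<psi> $ (1, 1))"
      by (simp add: two_qubit_eq_iff)
    then show ?thesis by blast
  qed
qed auto

lemma entangled_iff_det:
  "entangled \<psi> \<longleftrightarrow>
    is_state \<psi> \<and> \<psi> $ (0, 0) * \<psi> $ (1, 1) \<noteq> \<psi> $ (0, 1) * \<psi> $ (1, 0)"
  by (auto simp: entangled_def product_state_def product_iff_det)

section \<open>The plane orthogonal to the two given states\<close>

definition half_phase :: "real \<Rightarrow> real \<Rightarrow> complex" where
  "half_phase \<theta> \<theta>' = cis ((\<theta>' - \<theta>) / 2)"

lemma half_phase_mult_cnj [simp]:
  "half_phase \<theta> \<theta>' * cnj (half_phase \<theta> \<theta>') = 1" "cnj (half_phase \<theta> \<theta>') * half_phase \<theta> \<theta>' = 1"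
  by (simp_all add: half_phase_def cis_cnj cis_mult)

lemma half_phase_cancel [simp]:
  "half_phase \<theta> \<theta>' * (cnj (half_phase \<theta> \<theta>') * x) = x"
  "cnj (half_phase \<theta> \<theta>') * (half_phase \<theta> \<theta>' * x) = x"
  by (simp_all flip: mult.assoc)

text \<open>Translates every exponential in the definitions of \<open>Dval\<close>,
  \<open>tau\<close>, \<open>Cval\<close>, \<open>alpha\<close> and \<open>beta\<close> into powers
  and conjugates of one unit number.\<close>

lemma exp_half_phase:
  "exp (\<i> * complex_of_real ((\<theta>' - \<theta>) / 2)) = half_phase \<theta> \<theta>'"
  "exp (- \<i> * complex_of_real ((\<theta>' - \<theta>) / 2)) = cnj (half_phase \<theta> \<theta>')"
  "exp (\<i> * complex_of_real (\<theta>' - \<theta>)) = (half_phase \<theta> \<theta>')\<^sup>2"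
  by (simp_all add: half_phase_def cis_conv_exp cis_cnj exp_cnj power2_eq_square flip: exp_add)

definition complement_state :: "complex \<Rightarrow> complex \<Rightarrow> complex \<Rightarrow> two_qubit" where
  "complement_state e a b =
     a *s (ket 0 \<otimes> ket 0 - ket 1 \<otimes> ket 1) + b *s (ket 0 \<otimes> ket 1 - e\<^sup>2 *s (ket 1 \<otimes> ket 0))"

lemma complement_state_nth [simp]:
  "complement_state e a b $ (0, 0) = a" "complement_state e a b $ (0, 1) = b"
  "complement_state e a b $ (1, 0) = - (e\<^sup>2 * b)" "complement_state e a b $ (1, 1) = - a"
  by (simp_all add: complement_state_def)

lemma scale_complement_state: "z *s complement_state e a b = complement_state e (z * a) (z * b)"
  by (simp add: two_qubit_eq_iff mult_ac)

lemma hinner_Mmee_eq_0_iff: "hinner Mmee \<psi> = 0 \<longleftrightarrow> \<psi> $ (1, 1) = - \<psi> $ (0, 0)"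
proof -
  have "hinner Mmee \<psi> = (\<psi> $ (0, 0) + \<psi> $ (1, 1)) / sqrt 2"
    by (simp add: hinner_two_qubit Mmee_def add_divide_distrib)
  then show ?thesis by (simp add: add_eq_0_iff)
qed

lemma hinner_mMee_eq_0_iff:
  "hinner (mMee \<theta> \<theta>') \<psi> = 0 \<longleftrightarrow> \<psi> $ (1, 0) = - ((half_phase \<theta> \<theta>')\<^sup>2 * \<psi> $ (0, 1))"
proof -
  have "hinner (mMee \<theta> \<theta>') \<psi> = (cis (- \<theta>) * \<psi> $ (0, 1) + cis (- \<theta>') * \<psi> $ (1, 0)) / sqrt 2"
    by (simp add: hinner_two_qubit mMee_def add_divide_distrib cis_cnj flip: cis_conv_exp)
  \<comment> \<open>Pulling out \<open>cis (- \<theta>')\<close> leaves only the relative phase,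
    which is the square of the half phase.\<close>
  also have "\<dots> = cis (- \<theta>') * ((half_phase \<theta> \<theta>')\<^sup>2 * \<psi> $ (0, 1) + \<psi> $ (1, 0)) / sqrt 2"
    by (simp add: half_phase_def algebra_simps power2_eq_square cis_mult flip: mult.assoc)
  finally show ?thesis by (simp add: add_eq_0_iff)
qed

lemma is_state_Mmee: "is_state Mmee" and is_state_mMee: "is_state (mMee \<theta> \<theta>')"
  and hinner_Mmee_mMee: "hinner Mmee (mMee \<theta> \<theta>') = 0"
  unfolding is_state_iff_hinner
  by (simp_all add: hinner_two_qubit Mmee_def mMee_def cis_cnj cis_mult
      flip: of_real_mult cis_conv_exp)

lemma orthogonal_iff_complement_state:
  "hinner Mmee \<psi> = 0 \<and> hinner (mMee \<theta> \<theta>') \<psi> = 0 \<longleftrightarrow>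
    (\<exists>a b. \<psi> = complement_state (half_phase \<theta> \<theta>') a b)"
  by (auto simp: hinner_Mmee_eq_0_iff hinner_mMee_eq_0_iff two_qubit_eq_iff)

text \<open>The factor at \<open>(1, 0)\<close> has modulus one, so each parameter contributes
  twice. Hence unit vectors correspond to squared moduli summing to 1/2, and orthogonality becomes
  orthogonality of the parameter pairs in the complex plane squared.\<close>

lemma hinner_complement_state:
  "hinner (complement_state (half_phase \<theta> \<theta>') a b) (complement_state (half_phase \<theta> \<theta>') p q) =
    2 * (cnj a * p + cnj b * q)"
proof -
  let ?e = "half_phase \<theta> \<theta>'"
  have "(cnj ?e)\<^sup>2 * ?e\<^sup>2 = 1" by (simp flip: power_mult_distrib)
  then have "cnj (?e\<^sup>2 * b) * (?e\<^sup>2 * q) = cnj b * q" by (simp add: mult_ac)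
  then show ?thesis by (simp add: hinner_two_qubit)
qed

lemma is_state_complement_state:
  "is_state (complement_state (half_phase \<theta> \<theta>') a b) \<longleftrightarrow> (cmod a)\<^sup>2 + (cmod b)\<^sup>2 = 1 / 2"
proof -
  have "2 * (cnj a * a + cnj b * b) = complex_of_real (2 * ((cmod a)\<^sup>2 + (cmod b)\<^sup>2))"
    by (simp add: complex_norm_square mult.commute del: of_real_power)
  then have "is_state (complement_state (half_phase \<theta> \<theta>') a b) \<longleftrightarrow>
      2 * ((cmod a)\<^sup>2 + (cmod b)\<^sup>2) = 1"
    unfolding is_state_iff_hinner hinner_complement_state by (metis of_real_1 of_real_eq_iff)
  then show ?thesis by auto
qed

section \<open>Admissible parameters and their symmetries\<close>

lemma Dval_half_phase:
  "Dval \<theta> \<theta>' a b = half_phase \<theta> \<theta>' * cnj a * b + cnj (half_phase \<theta> \<theta>') * a * cnj b"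
  by (simp only: Dval_def exp_half_phase)

text \<open>The determinant of the coefficients is \<open>e\<^sup>2 * b\<^sup>2 - a\<^sup>2\<close>,
  and the expression that defines diagonality is \<open>cnj e * D\<close>, where \<open>e\<close> is
  the half phase.\<close>

lemma admissible_iff:
  "admissible \<theta> \<theta>' a b \<longleftrightarrow>
    entangled (complement_state (half_phase \<theta> \<theta>') a b) \<and>
    non_diagonal (complement_state (half_phase \<theta> \<theta>') a b)"
proof -
  let ?e = "half_phase \<theta> \<theta>'" and ?c = "complement_state (half_phase \<theta> \<theta>') a b"
  \<comment> \<open>The factor \<open>cnj ?e * ?e = 1\<close> is inserted so that
    \<open>cnj ?e\<close> can be taken out of both terms.\<close>
  have "cnj (?c $ (0, 0)) * ?c $ (0, 1) + cnj (?c $ (1, 0)) * ?c $ (1, 1) =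
      (cnj ?e * ?e) * (cnj a * b) + (cnj ?e)\<^sup>2 * cnj b * a"
    by simp
  also have "\<dots> = cnj ?e * Dval \<theta> \<theta>' a b"
    unfolding Dval_half_phase by (simp only: algebra_simps power2_eq_square)
  finally show ?thesis
    unfolding admissible_def exp_half_phase entangled_iff_det non_diagonal_def diagonal_def
      is_state_complement_state
    by (auto simp: half_phase_def power2_eq_square algebra_simps)
qed

text \<open>\<open>D\<close> only changes sign, and the determinant condition turns into its
  conjugate up to a unit factor.\<close>

lemma admissible_complement:
  assumes "admissible \<theta> \<theta>' a b"
  shows "admissible \<theta> \<theta>' (- cnj b) (cnj a)"
proof -
  let ?e = "half_phase \<theta> \<theta>'"
  have "Dval \<theta> \<theta>' (- cnj b) (cnj a) = - Dval \<theta> \<theta>' a b"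
    by (simp add: Dval_half_phase)
  moreover have "?e\<^sup>2 * b\<^sup>2 = a\<^sup>2" if "?e\<^sup>2 * (cnj a)\<^sup>2 = (cnj b)\<^sup>2"
  proof -
    have "b\<^sup>2 = (cnj ?e)\<^sup>2 * a\<^sup>2"
      using arg_cong[OF that, of cnj] by simp
    then have "?e\<^sup>2 * b\<^sup>2 = (?e * cnj ?e)\<^sup>2 * a\<^sup>2"
      by (simp only: power_mult_distrib mult.assoc)
    then show ?thesis by simp
  qed
  ultimately show ?thesis
    using assms unfolding admissible_def exp_half_phase by auto
qed

text \<open>Lets a global phase of the state be absorbed into the parameters: \<open>D\<close> is
  unchanged and the two sides of the determinant condition both acquire
  \<open>z\<^sup>2\<close>.\<close>

lemma admissible_scale:
  assumes "admissible \<theta> \<theta>' a b" "cmod z = 1"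
  shows "admissible \<theta> \<theta>' (z * a) (z * b)"
proof -
  have z: "z * cnj z = 1" using assms(2) by (simp add: complex_norm_square[symmetric])
  have "Dval \<theta> \<theta>' (z * a) (z * b) = (z * cnj z) * Dval \<theta> \<theta>' a b"
    by (simp add: Dval_half_phase algebra_simps)
  moreover have "z \<noteq> 0" using assms(2) by auto
  ultimately show ?thesis
    using assms z unfolding admissible_def
    by (auto simp: norm_mult power_mult_distrib mult.left_commute[of _ "z\<^sup>2"])
qed

section \<open>Orthonormal pairs in the orthogonal plane\<close>

text \<open>In two dimensions the vectors orthogonal to \<open>(a, b)\<close> form the line through
  \<open>(- cnj b, cnj a)\<close>; equal norms make the multiplier a phase.\<close>

lemma orthogonal_unit_pair:
  fixes a b p q :: complex
  assumes "(cmod a)\<^sup>2 + (cmod b)\<^sup>2 = 1 / 2" "(cmod p)\<^sup>2 + (cmod q)\<^sup>2 = 1 / 2"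
    and orth: "cnj a * p + cnj b * q = 0"
  obtains w where "cmod w = 1" "p = w * (- cnj b)" "q = w * cnj a"
proof -
  have n: "a * cnj a + b * cnj b = 1 / 2"
    using arg_cong[OF assms(1), of complex_of_real] by (simp add: complex_norm_square del: of_real_power)
  \<comment> \<open>Twice the determinant of the rows \<open>(a, b)\<close> and
    \<open>(p, q)\<close>; the 2 is the inverse of the squared norm 1/2.\<close>
  define w where "w = 2 * (a * q - b * p)"
  have q: "q = w * cnj a"
  proof -
    have "w * cnj a = 2 * ((a * cnj a + b * cnj b) * q - b * (cnj a * p + cnj b * q))"
      unfolding w_def by (simp add: algebra_simps)
    then show ?thesis using n orth by simp
  qed
  have p: "p = w * (- cnj b)"
  proof -
    have "w * (- cnj b) = 2 * ((a * cnj a + b * cnj b) * p - a * (cnj a * p + cnj b * q))"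
      unfolding w_def by (simp add: algebra_simps)
    then show ?thesis using n orth by simp
  qed
  have "(cmod w)\<^sup>2 * ((cmod a)\<^sup>2 + (cmod b)\<^sup>2) = (cmod p)\<^sup>2 + (cmod q)\<^sup>2"
    unfolding p q by (simp add: norm_mult power_mult_distrib algebra_simps)
  then have "(cmod w)\<^sup>2 = 1" using assms by simp
  then have "cmod w = 1" by (metis norm_ge_zero one_power2 power2_eq_iff_nonneg zero_le_one)
  with p q that show ?thesis by blast
qed

text \<open>The theorem in coordinates. Only the second state carries an explicit phase, since that
  of the first is part of \<open>a\<close> and \<open>b\<close>.\<close>

lemma completing_pair_iff:
  "entangled \<psi> \<and> non_diagonal \<psi> \<and> entangled \<phi> \<and> non_diagonal \<phi> \<and>
     orthonormal_basis [Mmee, mMee \<theta> \<theta>', \<psi>, \<phi>] \<longleftrightarrow>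
   (\<exists>a b w. admissible \<theta> \<theta>' a b \<and> cmod w = 1 \<and>
     \<psi> = complement_state (half_phase \<theta> \<theta>') a b \<and>
     \<phi> = w *s complement_state (half_phase \<theta> \<theta>') (- cnj b) (cnj a))"
  (is "?L \<longleftrightarrow> ?R")
proof -
  let ?c = "complement_state (half_phase \<theta> \<theta>')"
  have basis: "orthonormal_basis [Mmee, mMee \<theta> \<theta>', \<psi>, \<phi>] \<longleftrightarrow>
      is_state \<psi> \<and> is_state \<phi> \<and> (\<exists>a b. \<psi> = ?c a b) \<and> (\<exists>p q. \<phi> = ?c p q) \<and> hinner \<psi> \<phi> = 0"
    unfolding orthogonal_iff_complement_state[symmetric]
    using orthonormal_family_4[of Mmee "mMee \<theta> \<theta>'" \<psi> \<phi>]
      orthonormal_basis_iff[of "[Mmee, mMee \<theta> \<theta>', \<psi>, \<phi>]"]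
    by (simp add: is_state_Mmee is_state_mMee hinner_Mmee_mMee eval_nat_numeral) blast
  show ?thesis
  proof
    assume L: ?L
    then obtain a b p q where c: "\<psi> = ?c a b" "\<phi> = ?c p q" unfolding basis by blast
    with L have "hinner (?c a b) (?c p q) = 0" "is_state (?c a b)" "is_state (?c p q)"
      unfolding basis by simp_all
    then have "cnj a * p + cnj b * q = 0"
      "(cmod a)\<^sup>2 + (cmod b)\<^sup>2 = 1 / 2" "(cmod p)\<^sup>2 + (cmod q)\<^sup>2 = 1 / 2"
      unfolding hinner_complement_state is_state_complement_state mult_eq_0_iff by simp_all
    then obtain w where "cmod w = 1" "p = w * (- cnj b)" "q = w * cnj a"
      using orthogonal_unit_pair by metis
    moreover have "admissible \<theta> \<theta>' a b" using L c by (simp add: admissible_iff)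
    ultimately show ?R using c unfolding scale_complement_state by blast
  next
    assume ?R
    then obtain a b w where adm: "admissible \<theta> \<theta>' a b" and w: "cmod w = 1"
      and c: "\<psi> = ?c a b" "\<phi> = ?c (w * - cnj b) (w * cnj a)"
      unfolding scale_complement_state by blast
    have adm': "admissible \<theta> \<theta>' (w * - cnj b) (w * cnj a)"
      using admissible_scale[OF admissible_complement[OF adm] w] .
    have "hinner \<psi> \<phi> = 0"
      unfolding c hinner_complement_state by simp
    then show ?L
      using adm adm' c unfolding basis admissible_iff by (auto simp: entangled_def)
  qed
qed

section \<open>Schmidt coefficients as moduli of \<open>Cval\<close>\<close>

definition Dsign :: "real \<Rightarrow> real \<Rightarrow> complex \<Rightarrow> complex \<Rightarrow> complex" where
  "Dsign \<theta> \<theta>' a b = Dval \<theta> \<theta>' a b / cmod (Dval \<theta> \<theta>' a b)"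

text \<open>All three facts rest on \<open>Dval\<close> being real. The first one includes
  \<open>D = 0\<close>, where division by zero makes both sides vanish.\<close>

lemma Dval_mult_Dsign: "Dval \<theta> \<theta>' a b * Dsign \<theta> \<theta>' a b = cmod (Dval \<theta> \<theta>' a b)"
  and Dsign_cnj [simp]: "cnj (Dsign \<theta> \<theta>' a b) = Dsign \<theta> \<theta>' a b"
  and Dsign_square: "Dval \<theta> \<theta>' a b \<noteq> 0 \<Longrightarrow> Dsign \<theta> \<theta>' a b * Dsign \<theta> \<theta>' a b = 1"
proof -
  let ?D = "Dval \<theta> \<theta>' a b"
  have real: "cnj ?D = ?D" by (simp add: Dval_half_phase)
  then have sq: "?D * ?D = complex_of_real (cmod ?D) * complex_of_real (cmod ?D)"
    using complex_norm_square[of ?D] by (simp add: power2_eq_square)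
  then show "?D * Dsign \<theta> \<theta>' a b = cmod ?D" by (simp add: Dsign_def)
  show "cnj (Dsign \<theta> \<theta>' a b) = Dsign \<theta> \<theta>' a b" using real by (simp add: Dsign_def)
  show "Dsign \<theta> \<theta>' a b * Dsign \<theta> \<theta>' a b = 1" if "?D \<noteq> 0"
    using that sq by (simp add: Dsign_def)
qed

lemma Cval_half_phase:
  "Cval \<theta> \<theta>' a b j = cnj (half_phase \<theta> \<theta>') * Dsign \<theta> \<theta>' a b * a + (- 1) ^ j * b"
  by (simp only: Cval_def exp_half_phase Dsign_def)

text \<open>Put \<open>x = e * cnj a * b\<close>, so that \<open>D = x + cnj x\<close>. Then the
  square of \<open>D\<close> is 2 Re(x^2) + 2 |a|^2 |b|^2, while the determinant term is |a|^4 +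
  |b|^4 - 2 Re(x^2).\<close>

lemma cmod_det_Dval:
  "(cmod (a\<^sup>2 - (half_phase \<theta> \<theta>')\<^sup>2 * b\<^sup>2))\<^sup>2 + (cmod (Dval \<theta> \<theta>' a b))\<^sup>2 =
    ((cmod a)\<^sup>2 + (cmod b)\<^sup>2)\<^sup>2"
proof -
  let ?e = "half_phase \<theta> \<theta>'"
  have sq: "(complex_of_real (cmod z))\<^sup>2 = z * cnj z" for z
    by (simp add: complex_norm_square flip: of_real_power)
  have "complex_of_real ((cmod (a\<^sup>2 - ?e\<^sup>2 * b\<^sup>2))\<^sup>2 + (cmod (Dval \<theta> \<theta>' a b))\<^sup>2) =
      complex_of_real (((cmod a)\<^sup>2 + (cmod b)\<^sup>2)\<^sup>2)"
    unfolding of_real_add of_real_power[of _ 2] sq Dval_half_phase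
    by (simp add: power2_eq_square algebra_simps)
  then show ?thesis using of_real_eq_iff by blast
qed

lemma admissible_cmod_det_Dval:
  assumes "admissible \<theta> \<theta>' a b"
  shows "(cmod (a\<^sup>2 - (half_phase \<theta> \<theta>')\<^sup>2 * b\<^sup>2))\<^sup>2 + (cmod (Dval \<theta> \<theta>' a b))\<^sup>2 = (1 / 2)\<^sup>2"
  using assms unfolding cmod_det_Dval admissible_def by metis

text \<open>On expanding, the square terms give |a|^2 + |b|^2 = 1/2, and the cross terms combine to
  \<open>D\<close> times its sign, that is |D|, with the factor \<open>(- 1) ^ j\<close>.\<close>

lemma cmod_Cval_square:
  assumes "admissible \<theta> \<theta>' a b"
  shows "(cmod (Cval \<theta> \<theta>' a b j))\<^sup>2 = 1 / 2 + (- 1) ^ j * cmod (Dval \<theta> \<theta>' a b)"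
proof -
  let ?e = "half_phase \<theta> \<theta>'" and ?s = "Dsign \<theta> \<theta>' a b" and ?g = "(- 1) ^ j :: complex"
  have s: "?s * ?s = 1" using assms by (simp add: admissible_def Dsign_square)
  have g: "?g * ?g = 1" by (simp flip: power_mult_distrib)
  have n: "a * cnj a + b * cnj b = 1 / 2"
    using assms arg_cong[of "(cmod a)\<^sup>2 + (cmod b)\<^sup>2" "1 / 2" complex_of_real]
    by (simp add: admissible_def complex_norm_square del: of_real_power)
  have "complex_of_real ((cmod (Cval \<theta> \<theta>' a b j))\<^sup>2) =
      (?e * cnj ?e) * (?s * ?s) * (a * cnj a) + (?g * ?g) * (b * cnj b) +
      ?g * (Dval \<theta> \<theta>' a b * ?s)"
    unfolding complex_norm_square Cval_half_phase Dval_half_phase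
    by (simp del: half_phase_mult_cnj add: algebra_simps)
  also have "\<dots> = complex_of_real (1 / 2 + (- 1) ^ j * cmod (Dval \<theta> \<theta>' a b))"
    using n by (simp add: s g Dval_mult_Dsign)
  finally show ?thesis using of_real_eq_iff by blast
qed

text \<open>By \<open>admissible_cmod_det_Dval\<close> the inner square root is 2 |D|, so the outer
  radicand is exactly the value found in \<open>cmod_Cval_square\<close>.\<close>

lemma tau_eq_cmod_Cval:
  assumes "admissible \<theta> \<theta>' a b"
  shows "tau \<theta> \<theta>' a b j = cmod (Cval \<theta> \<theta>' a b j)"
proof -
  let ?D = "Dval \<theta> \<theta>' a b"
  have "1 - 4 * (cmod (a\<^sup>2 - (half_phase \<theta> \<theta>')\<^sup>2 * b\<^sup>2))\<^sup>2 = (2 * cmod ?D)\<^sup>2"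
    using admissible_cmod_det_Dval[OF assms] by (simp add: power_mult_distrib power_divide)
  then have "tau \<theta> \<theta>' a b j = sqrt ((1 + (- 1) ^ j * (2 * cmod ?D)) / 2)"
    by (simp only: tau_def exp_half_phase real_sqrt_abs) simp
  also have "(1 + (- 1) ^ j * (2 * cmod ?D)) / 2 = (cmod (Cval \<theta> \<theta>' a b j))\<^sup>2"
    unfolding cmod_Cval_square[OF assms] by (simp add: field_simps)
  finally show ?thesis by simp
qed

text \<open>The nonzero determinant forces |D| < 1/2 strictly, so 1/2 - |D| and 1/2 + |D| are both
  positive. This makes the phase \<open>C / |C|\<close> in \<open>alpha\<close> a genuine unit
  number.\<close>

lemma Cval_nonzero:
  assumes "admissible \<theta> \<theta>' a b"
  shows "Cval \<theta> \<theta>' a b j \<noteq> 0"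
proof -
  let ?D = "Dval \<theta> \<theta>' a b"
  have "0 < cmod (a\<^sup>2 - (half_phase \<theta> \<theta>')\<^sup>2 * b\<^sup>2)"
    using assms unfolding admissible_def exp_half_phase by auto
  then have "(cmod ?D)\<^sup>2 < (1 / 2)\<^sup>2"
    using admissible_cmod_det_Dval[OF assms] by (metis less_add_same_cancel2 zero_less_power)
  then have "cmod ?D < 1 / 2" by (rule power2_less_imp_less) simp
  then have "0 < (cmod (Cval \<theta> \<theta>' a b j))\<^sup>2"
    unfolding cmod_Cval_square[OF assms] by (cases "even j") (auto intro: add_pos_nonneg)
  then show ?thesis by auto
qed

section \<open>The Schmidt sums in coordinates\<close>

lemma alpha_nth:
  "alpha \<theta> \<theta>' a b j $ 0 = - (sgn (Cval \<theta> \<theta>' a b j) * (cnj (half_phase \<theta> \<theta>') * Dsign \<theta> \<theta>' a b) / sqrt 2)"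
  "alpha \<theta> \<theta>' a b j $ 1 = sgn (Cval \<theta> \<theta>' a b j) * (- 1) ^ j / sqrt 2"
  unfolding alpha_def exp_half_phase Dsign_def[symmetric]
  by (simp_all add: sgn_eq)

lemma beta_nth:
  "beta \<theta> \<theta>' a b j $ 0 = half_phase \<theta> \<theta>' * Dsign \<theta> \<theta>' a b / sqrt 2"
  "beta \<theta> \<theta>' a b j $ 1 = (- 1) ^ j / sqrt 2"
  unfolding beta_def exp_half_phase Dsign_def[symmetric]
  by simp_all


text \<open>Written with denominator \<open>tau\<close>, the phase in \<open>alpha\<close> cancels
  against the Schmidt coefficient.\<close>

lemma sgn_Cval:
  assumes "admissible \<theta> \<theta>' a b"
  shows "sgn (Cval \<theta> \<theta>' a b j) = Cval \<theta> \<theta>' a b j / tau \<theta> \<theta>' a b j" "tau \<theta> \<theta>' a b j \<noteq> 0"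
  using Cval_nonzero[OF assms] by (simp_all add: tau_eq_cmod_Cval[OF assms] sgn_eq)

lemma of_real_sqrt2_square: "complex_of_real (sqrt 2) * complex_of_real (sqrt 2) = 2"
  by (simp flip: of_real_mult)

text \<open>After the cancellation of \<open>tau\<close>, the coordinates involve only half the sum
  and half the difference of the two values of \<open>Cval\<close>, which are
  \<open>cnj e * s * a\<close> and \<open>b\<close> for the half phase \<open>e\<close> and the sign
  \<open>s\<close> of \<open>D\<close>.\<close>

lemma mmEe_eq_complement_state:
  fixes \<theta> \<theta>' a b
  defines "k \<equiv> - cnj (half_phase \<theta> \<theta>') * Dsign \<theta> \<theta>' a b"
  assumes adm: "admissible \<theta> \<theta>' a b"
  shows "mmEe \<theta> \<theta>' a b = k *s complement_state (half_phase \<theta> \<theta>') a b"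
proof -
  let ?s = "Dsign \<theta> \<theta>' a b"
  have s: "?s * ?s = 1" "?s * (?s * x) = x" for x
    using adm by (simp_all add: admissible_def Dsign_square flip: mult.assoc)
  show ?thesis
    unfolding k_def
    by (simp add: mmEe_def two_qubit_eq_iff alpha_nth beta_nth sgn_Cval[OF adm]
        of_real_sqrt2_square mult.assoc)
      (simp add: Cval_half_phase field_simps power2_eq_square s)
qed

text \<open>The same cancellation, applied to the conjugates of \<open>Cval\<close>. Here the half
  phases and signs cancel completely, so no extra phase remains.\<close>

lemma mmeE_eq_complement_state:
  assumes adm: "admissible \<theta> \<theta>' a b"
  shows "mmeE \<theta> \<theta>' a b = complement_state (half_phase \<theta> \<theta>') (- cnj b) (cnj a)"
proof -
  let ?s = "Dsign \<theta> \<theta>' a b"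
  have s: "?s * ?s = 1" "?s * (?s * x) = x" for x
    using adm by (simp_all add: admissible_def Dsign_square flip: mult.assoc)
  show ?thesis
    by (simp add: mmeE_def two_qubit_eq_iff alpha_nth beta_nth sgn_Cval[OF adm] of_real_sqrt2_square)
      (simp add: Cval_half_phase field_simps power2_eq_square s)
qed

lemma cmod_scale_factor:
  assumes "admissible \<theta> \<theta>' a b"
  shows "cmod (- cnj (half_phase \<theta> \<theta>') * Dsign \<theta> \<theta>' a b) = 1"
  using assms by (simp add: norm_mult half_phase_def Dsign_def norm_divide admissible_def)

section \<open>Orthonormality of the Schmidt vectors\<close>

lemma orthonormal_family_cnj_vec:
  fixes u :: "'j \<Rightarrow> complex ^ 'n"
  assumes "orthonormal_family J u"
  shows "orthonormal_family J (\<lambda>j. cnj_vec (u j))"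
proof -
  have "hinner (cnj_vec x) (cnj_vec y) = cnj (hinner x y)" for x y :: "complex ^ 'n"
    by (simp add: hinner_def)
  then show ?thesis using assms by (simp add: orthonormal_family_def)
qed

text \<open>Used to absorb the signs \<open>(- 1) ^ j\<close> of the second decomposition into its
  left vectors.\<close>

lemma orthonormal_family_scale:
  fixes u :: "'j \<Rightarrow> complex ^ 'n"
  assumes "orthonormal_family J u" "\<And>j. j \<in> J \<Longrightarrow> cmod (c j) = 1"
  shows "orthonormal_family J (\<lambda>j. c j *s u j)"
proof -
  have "hinner (x *s v) (y *s w) = (cnj x * y) * hinner v w" for x y and v w :: "complex ^ 'n"
    by (simp add: hinner_def sum_distrib_left mult_ac)
  moreover have "cnj (c j) * c j = 1" if "j \<in> J" for j
    using assms(2)[OF that] complex_norm_square[of "c j"] by (simp add: mult.commute)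
  ultimately show ?thesis using assms(1) by (simp add: orthonormal_family_def)
qed

text \<open>The vectors are \<open>(x, 1)\<close> and \<open>(x, -1)\<close> over
  \<open>sqrt 2\<close> with |x| = 1, so their inner product is (|x|^2 - 1)/2 = 0.\<close>

lemma orthonormal_beta:
  assumes "admissible \<theta> \<theta>' a b"
  shows "orthonormal_family {..<2} (beta \<theta> \<theta>' a b)"
proof -
  have s: "Dsign \<theta> \<theta>' a b * Dsign \<theta> \<theta>' a b = 1"
    using assms by (simp add: admissible_def Dsign_square)
  show ?thesis
    by (auto simp: orthonormal_family_def numeral_2_eq_2 less_Suc_eq hinner_qubit beta_nth s
        mult.assoc mult.left_commute[of "Dsign \<theta> \<theta>' a b"] of_real_sqrt2_square)
qed

text \<open>As for \<open>beta\<close>, with an additional phase on each vector, which has modulus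
  one because \<open>Cval\<close> is nonzero.\<close>

lemma orthonormal_alpha:
  assumes "admissible \<theta> \<theta>' a b"
  shows "orthonormal_family {..<2} (alpha \<theta> \<theta>' a b)"
proof -
  have s: "Dsign \<theta> \<theta>' a b * Dsign \<theta> \<theta>' a b = 1"
    using assms by (simp add: admissible_def Dsign_square)
  have s': "Dsign \<theta> \<theta>' a b * (Dsign \<theta> \<theta>' a b * x) = x" for x
    using s by (simp flip: mult.assoc)
  have C: "sgn (Cval \<theta> \<theta>' a b j) * cnj (sgn (Cval \<theta> \<theta>' a b j)) = 1" for j
    using Cval_nonzero[OF assms, of j] by (simp add: norm_sgn flip: complex_norm_square)
  show ?thesis
    by (auto simp: orthonormal_family_def numeral_2_eq_2 less_Suc_eq hinner_qubit alpha_nth s' C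
        mult_ac of_real_sqrt2_square)
qed

section \<open>Global phases: from the coordinate form to the Schmidt form\<close>

theorem theorem21:
  fixes \<theta> \<theta>' :: real
  shows
    "(\<forall>\<psi> \<phi> :: two_qubit.
        (entangled \<psi> \<and> non_diagonal \<psi> \<and> entangled \<phi> \<and> non_diagonal \<phi> \<and>
         orthonormal_basis [Mmee, mMee \<theta> \<theta>', \<psi>, \<phi>])
        \<longleftrightarrow>
        (\<exists>a b z w :: complex.
           admissible \<theta> \<theta>' a b \<and> cmod z = 1 \<and> cmod w = 1 \<and>
           \<psi> = z *s mmEe \<theta> \<theta>' a b \<and> \<phi> = w *s mmeE \<theta> \<theta>' a b)) \<and>
     (\<forall>a b :: complex. admissible \<theta> \<theta>' a b \<longrightarrow>
        schmidt_decomposition 2 (tau \<theta> \<theta>' a b) (alpha \<theta> \<theta>' a b) (beta \<theta> \<theta>' a b)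
          (mmEe \<theta> \<theta>' a b) \<and>
        schmidt_decomposition 2 (tau \<theta> \<theta>' a b)
          (\<lambda>j. (-1) ^ j *s cnj_vec (beta \<theta> \<theta>' a b j)) (\<lambda>j. cnj_vec (alpha \<theta> \<theta>' a b j))
          (mmeE \<theta> \<theta>' a b))"
proof (intro conjI allI impI)
  let ?c = "complement_state (half_phase \<theta> \<theta>')"
  fix \<psi> \<phi> :: two_qubit
  show "(entangled \<psi> \<and> non_diagonal \<psi> \<and> entangled \<phi> \<and> non_diagonal \<phi> \<and>
         orthonormal_basis [Mmee, mMee \<theta> \<theta>', \<psi>, \<phi>])
        \<longleftrightarrow>
        (\<exists>a b z w :: complex.
           admissible \<theta> \<theta>' a b \<and> cmod z = 1 \<and> cmod w = 1 \<and>
           \<psi> = z *s mmEe \<theta> \<theta>' a b \<and> \<phi> = w *s mmeE \<theta> \<theta>' a b)"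
    unfolding completing_pair_iff
  proof (intro iffI; elim exE conjE)
    fix a b w
    assume adm: "admissible \<theta> \<theta>' a b" and w: "cmod w = 1"
      and c: "\<psi> = ?c a b" "\<phi> = w *s ?c (- cnj b) (cnj a)"
    \<comment> \<open>The phase by which the first Schmidt sum differs from its coordinate form; its
      inverse serves as \<open>z\<close>.\<close>
    define k where "k = - cnj (half_phase \<theta> \<theta>') * Dsign \<theta> \<theta>' a b"
    have k: "cmod k = 1" unfolding k_def by (rule cmod_scale_factor[OF adm])
    then have "\<psi> = inverse k *s mmEe \<theta> \<theta>' a b"
      unfolding c mmEe_eq_complement_state[OF adm] k_def[symmetric]
      by (cases "k = 0") (simp_all add: vector_smult_assoc)
    moreover have "\<phi> = w *s mmeE \<theta> \<theta>' a b"
      unfolding c mmeE_eq_complement_state[OF adm] ..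
    moreover have "cmod (inverse k) = 1" using k by (simp add: norm_inverse)
    ultimately show "\<exists>a b z w. admissible \<theta> \<theta>' a b \<and> cmod z = 1 \<and> cmod w = 1 \<and>
        \<psi> = z *s mmEe \<theta> \<theta>' a b \<and> \<phi> = w *s mmeE \<theta> \<theta>' a b"
      using adm w by blast
  next
    fix a b z w
    assume adm: "admissible \<theta> \<theta>' a b" and z: "cmod z = 1" and w: "cmod w = 1"
      and c: "\<psi> = z *s mmEe \<theta> \<theta>' a b" "\<phi> = w *s mmeE \<theta> \<theta>' a b"
    \<comment> \<open>Collects \<open>z\<close> and the phase of the first Schmidt sum; the
      coordinate form then has parameters \<open>k * a\<close> and \<open>k * b\<close>.\<close>
    define k where "k = z * (- cnj (half_phase \<theta> \<theta>') * Dsign \<theta> \<theta>' a b)"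
    have k: "cmod k = 1"
      unfolding k_def norm_mult[of z] z cmod_scale_factor[OF adm] by simp
    then have kk: "k * cnj k = 1" by (simp flip: complex_norm_square)
    have "\<psi> = ?c (k * a) (k * b)"
      unfolding c mmEe_eq_complement_state[OF adm] k_def scale_complement_state
      by (simp only: mult.assoc)
    \<comment> \<open>Scaling the parameters by \<open>k\<close> scales the complementary state by
      \<open>cnj k\<close>, which the extra factor \<open>k\<close> in the phase undoes.\<close>
    moreover have "\<phi> = (w * k) *s ?c (- cnj (k * b)) (cnj (k * a))"
    proof -
      have "w * k * - cnj (k * b) = (k * cnj k) * (w * - cnj b)"
        "w * k * cnj (k * a) = (k * cnj k) * (w * cnj a)"
        by (simp_all add: mult_ac)
      then show ?thesis
        unfolding c mmeE_eq_complement_state[OF adm] scale_complement_state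
        by (simp only: kk mult_1)
    qed
    moreover have "cmod (w * k) = 1" using w k by (simp add: norm_mult)
    ultimately show "\<exists>a b w. admissible \<theta> \<theta>' a b \<and> cmod w = 1 \<and>
        \<psi> = ?c a b \<and> \<phi> = w *s ?c (- cnj b) (cnj a)"
      using admissible_scale[OF adm k] by blast
  qed
next
  fix a b assume adm: "admissible \<theta> \<theta>' a b"
  \<comment> \<open>Entanglement is derived here because it includes the unit norm that a Schmidt
    decomposition requires.\<close>
  have "entangled (mmEe \<theta> \<theta>' a b)"
    using admissible_scale[OF adm cmod_scale_factor[OF adm]]
    unfolding mmEe_eq_complement_state[OF adm] admissible_iff scale_complement_state by blast
  then show "schmidt_decomposition 2 (tau \<theta> \<theta>' a b) (alpha \<theta> \<theta>' a b) (beta \<theta> \<theta>' a b)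
      (mmEe \<theta> \<theta>' a b)"
    using orthonormal_alpha[OF adm] orthonormal_beta[OF adm]
    by (simp add: schmidt_decomposition_def entangled_def tau_eq_cmod_Cval[OF adm]
        mmEe_def numeral_2_eq_2 lessThan_Suc add.commute)
  have "entangled (mmeE \<theta> \<theta>' a b)"
    using admissible_complement[OF adm]
    unfolding mmeE_eq_complement_state[OF adm] admissible_iff by blast
  then show "schmidt_decomposition 2 (tau \<theta> \<theta>' a b)
      (\<lambda>j. (-1) ^ j *s cnj_vec (beta \<theta> \<theta>' a b j)) (\<lambda>j. cnj_vec (alpha \<theta> \<theta>' a b j))
      (mmeE \<theta> \<theta>' a b)"
    using orthonormal_family_cnj_vec[OF orthonormal_alpha[OF adm]]
      orthonormal_family_scale[OF orthonormal_family_cnj_vec[OF orthonormal_beta[OF adm]],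
        of "\<lambda>j. (- 1) ^ j"]
    by (simp add: schmidt_decomposition_def entangled_def tau_eq_cmod_Cval[OF adm]
        mmeE_def numeral_2_eq_2 lessThan_Suc two_qubit_eq_iff algebra_simps norm_power)
qed

end
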